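(* For $n=2^{k}$ a power of two, let $B_{1/n}^n$ be a maximal class of pairwise non-isomorphic locally $1/n$-biased functions on $\{-1,1\}^n$. Then $|B_{1/n}^n|$ is super-exponential in $n$; that is, for every constant $A>1$ one has $|B_{1/n}^n|\ge A^n$ for all sufficiently large powers of two $n=2^k$.
   Context: The hypercube $\{-1,1\}^n$ is regarded as a graph in which two vertices are adjacent iff they differ in exactly one coordinate. A function $f:\{-1,1\}^n\to\{-1,1\}$ is locally $p$-biased if for every vertex $x$, $|\{y\sim x : f(y)=1\}|/n = p$. Two functions $f,g:\{-1,1\}^n\to\{-1,1\}$ are isomorphic if there is a graph automorphism $\psi$ of the hypercube with $f\circ\psi=g$, and non-isomorphic otherwise. *)

theory Defs
  imports Complex_Main "HOL-Library.FuncSet"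
begin

text \<open>Points of the cube, and functions on it, are extensional (equal to \<open>undefined\<close> outside
  their domain), so that equality and cardinality mean what they mean on paper.\<close>

definition cube :: "nat \<Rightarrow> (nat \<Rightarrow> int) set" where
  "cube n = {..<n} \<rightarrow>\<^sub>E {-1, 1}"

definition cube_adj :: "nat \<Rightarrow> (nat \<Rightarrow> int) \<Rightarrow> (nat \<Rightarrow> int) \<Rightarrow> bool" where
  "cube_adj n x y \<longleftrightarrow> x \<in> cube n \<and> y \<in> cube n \<and> card {i. i < n \<and> x i \<noteq> y i} = 1"

definition cube_automorphism :: "nat \<Rightarrow> ((nat \<Rightarrow> int) \<Rightarrow> (nat \<Rightarrow> int)) \<Rightarrow> bool" where
  "cube_automorphism n \<psi> \<longleftrightarrow> bij_betw \<psi> (cube n) (cube n) \<and>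
     (\<forall>x\<in>cube n. \<forall>y\<in>cube n. cube_adj n (\<psi> x) (\<psi> y) \<longleftrightarrow> cube_adj n x y)"

definition boolean_functions :: "nat \<Rightarrow> ((nat \<Rightarrow> int) \<Rightarrow> int) set" where
  "boolean_functions n = cube n \<rightarrow>\<^sub>E {-1, 1}"

definition locally_biased :: "nat \<Rightarrow> real \<Rightarrow> ((nat \<Rightarrow> int) \<Rightarrow> int) \<Rightarrow> bool" where
  "locally_biased n p f \<longleftrightarrow> f \<in> boolean_functions n \<and>
     (\<forall>x\<in>cube n. real (card {y. cube_adj n x y \<and> f y = 1}) / real n = p)"

definition isomorphic_functions ::
    "nat \<Rightarrow> ((nat \<Rightarrow> int) \<Rightarrow> int) \<Rightarrow> ((nat \<Rightarrow> int) \<Rightarrow> int) \<Rightarrow> bool" where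
  "isomorphic_functions n f g \<longleftrightarrow>
     (\<exists>\<psi>. cube_automorphism n \<psi> \<and> (\<forall>x\<in>cube n. (f \<circ> \<psi>) x = g x))"

definition nonisomorphic_class :: "nat \<Rightarrow> real \<Rightarrow> ((nat \<Rightarrow> int) \<Rightarrow> int) set \<Rightarrow> bool" where
  "nonisomorphic_class n p B \<longleftrightarrow> B \<subseteq> {f. locally_biased n p f} \<and>
     pairwise (\<lambda>f g. \<not> isomorphic_functions n f g) B"

text \<open>Maximality is with respect to inclusion. As isomorphism is an equivalence relation, such a
  class is a system of representatives of all isomorphism classes, so this agrees with
  maximality of the cardinality.\<close>

definition maximal_nonisomorphic_class :: "nat \<Rightarrow> real \<Rightarrow> ((nat \<Rightarrow> int) \<Rightarrow> int) set \<Rightarrow> bool" where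
  "maximal_nonisomorphic_class n p B \<longleftrightarrow> nonisomorphic_class n p B \<and>
     (\<forall>B'. nonisomorphic_class n p B' \<and> B \<subseteq> B' \<longrightarrow> B' = B)"

end

theory Submission
  imports Defs "HOL-Real_Asymp.Real_Asymp"
begin

text \<open>
  A locally \<open>1/n\<close>-biased function is the indicator of a set of vertices such that every vertex of
  the cube has exactly one neighbour in the set. The theorem holds because there are
  doubly exponentially many such functions, while an isomorphism class is only of size
  \<open>2 ^ O(n\<^sup>2)\<close>.

  Many functions come from a doubling construction in the style of Vasil'ev's perfect codes.
  Write a point of the \<open>2h\<close>-dimensional cube as a pair \<open>(x, y)\<close> of points of the
  \<open>h\<close>-dimensional one, let \<open>T\<close> be a set in dimension \<open>h\<close> that meets every
  neighbourhood once, and let \<open>\<lambda>\<close> be any assignment of signs to \<open>T\<close>. With \<open>xy\<close> the coordinatewise product, the set of all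
  \<open>(x, y)\<close> with \<open>xy \<in> T\<close> and \<open>\<Prod> x\<^sub>i = \<lambda>(xy)\<close> again meets every neighbourhood once:
  exactly one coordinate \<open>i\<close> of \<open>xy\<close> can be flipped to land in \<open>T\<close>, this can be done by
  flipping \<open>x\<^sub>i\<close> or \<open>y\<^sub>i\<close>, and only the first choice changes the sign of \<open>\<Prod> x\<^sub>i\<close>, so exactly one
  of the two fits \<open>\<lambda>\<close> (\<open>doubled_biased\<close>). Different \<open>\<lambda>\<close> give different functions, and
  \<open>T\<close> has at least \<open>2 ^ h / h\<close> elements because the neighbourhoods of its elements cover the
  cube; this gives at least \<open>2 ^ (2 ^ h / h)\<close> functions.

  An automorphism is determined by its values at one vertex and at the neighbours of that vertex
  (\<open>automorphism_determined\<close>), since two vertices have at most two common neighbours. Hence there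
  are at most \<open>(2 ^ n) ^ (n + 1)\<close> automorphisms. By maximality every locally biased function is
  isomorphic to a member of the class, and dividing the two counts gives the result.
\<close>

section \<open>Neighbours in the cube\<close>

definition flip :: "(nat \<Rightarrow> int) \<Rightarrow> nat \<Rightarrow> nat \<Rightarrow> int" where
  "flip x i = x(i := - x i)"

lemma flip_flip [simp]: "flip (flip x i) i = x"
  by (auto simp: flip_def)

lemma flip_commute: "flip (flip x i) j = flip (flip x j) i"
  by (auto simp: flip_def fun_eq_iff)

lemma cube_values: "x \<in> cube n \<Longrightarrow> i < n \<Longrightarrow> x i = 1 \<or> x i = -1"
  by (auto simp: cube_def dest!: PiE_mem)

lemma cube_nonzero: "x \<in> cube n \<Longrightarrow> i < n \<Longrightarrow> x i \<noteq> 0"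
  using cube_values by fastforce

lemma cube_ext:
  assumes "x \<in> cube n" "y \<in> cube n" "\<And>i. i < n \<Longrightarrow> x i = y i"
  shows "x = y"
  using assms unfolding cube_def by (intro PiE_ext) auto

lemma flip_in_cube: "x \<in> cube n \<Longrightarrow> i < n \<Longrightarrow> flip x i \<in> cube n"
  by (force simp: cube_def flip_def PiE_def Pi_def extensional_def)

lemma flip_index_unique:
  assumes "x \<in> cube n" "i < n" "flip x i = flip x j"
  shows "i = j"
proof (rule ccontr)
  assume "i \<noteq> j"
  then have "flip x j i = x i" by (simp add: flip_def)
  moreover have "flip x i i = - x i" by (simp add: flip_def)
  ultimately show False using assms cube_nonzero[of x n i] by simp
qed

lemma finite_cube: "finite (cube n)"
  unfolding cube_def by (intro finite_PiE) auto

lemma card_cube: "card (cube n) = 2 ^ n"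
  unfolding cube_def by (simp add: card_PiE numeral_2_eq_2)

lemma finite_boolean_functions: "finite (boolean_functions n)"
  unfolding boolean_functions_def by (intro finite_PiE finite_cube) auto

lemma cube_adj_iff_flip:
  "cube_adj n x y \<longleftrightarrow> x \<in> cube n \<and> (\<exists>i<n. y = flip x i)"
proof
  assume *: "cube_adj n x y"
  then obtain i where i: "{i. i < n \<and> x i \<noteq> y i} = {i}"
    by (auto simp: cube_adj_def card_1_singleton_iff)
  have x: "x \<in> cube n" and y: "y \<in> cube n" using * by (auto simp: cube_adj_def)
  have "i < n" "x i \<noteq> y i" using i by auto
  moreover have "y = flip x i"
  proof (rule cube_ext[OF y flip_in_cube[OF x \<open>i < n\<close>]])
    fix j assume j: "j < n"
    show "y j = flip x i j"
    proof (cases "j = i")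
      case True
      then show ?thesis
        using cube_values[OF x j] cube_values[OF y j] \<open>x i \<noteq> y i\<close> by (auto simp: flip_def)
    next
      case False
      then have "j \<notin> {i. i < n \<and> x i \<noteq> y i}" using i by simp
      then show ?thesis using False j by (simp add: flip_def)
    qed
  qed
  ultimately show "x \<in> cube n \<and> (\<exists>i<n. y = flip x i)" using x by blast
next
  assume "x \<in> cube n \<and> (\<exists>i<n. y = flip x i)"
  then obtain i where x: "x \<in> cube n" and i: "i < n" and y: "y = flip x i" by blast
  have "{j. j < n \<and> x j \<noteq> y j} = {i}"
    using i cube_nonzero[OF x i] by (auto simp: y flip_def)
  then show "cube_adj n x y" using x flip_in_cube[OF x i] y by (simp add: cube_adj_def)
qed

lemma cube_adj_flip: "x \<in> cube n \<Longrightarrow> i < n \<Longrightarrow> cube_adj n x (flip x i)"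
  by (auto simp: cube_adj_iff_flip)

text \<open>Density \<open>1/n\<close> means exactly one neighbour, which is most convenient as a statement about
  the coordinate to be flipped.\<close>

lemma locally_biased_iff:
  assumes "n > 0"
  shows "locally_biased n (1 / real n) f \<longleftrightarrow>
    f \<in> boolean_functions n \<and> (\<forall>x\<in>cube n. \<exists>!i. i < n \<and> f (flip x i) = 1)"
proof -
  have "real (card {y. cube_adj n x y \<and> f y = 1}) / real n = 1 / real n \<longleftrightarrow>
      (\<exists>!i. i < n \<and> f (flip x i) = 1)" if x: "x \<in> cube n" for x
  proof -
    have "{y. cube_adj n x y \<and> f y = 1} = flip x ` {i. i < n \<and> f (flip x i) = 1}"
      using x by (auto simp: cube_adj_iff_flip)
    moreover have "inj_on (flip x) {i. i < n \<and> f (flip x i) = 1}"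
      by (rule inj_onI) (blast intro: flip_index_unique[OF x])
    ultimately have "card {y. cube_adj n x y \<and> f y = 1} = card {i. i < n \<and> f (flip x i) = 1}"
      by (simp add: card_image)
    moreover have "card S = 1 \<longleftrightarrow> (\<exists>!i. i \<in> S)" for S :: "nat set"
      by (auto simp: card_1_singleton_iff)
    ultimately show ?thesis using assms by simp
  qed
  then show ?thesis unfolding locally_biased_def by blast
qed

section \<open>The number of automorphisms\<close>

text \<open>Two distinct vertices have at most two common neighbours: the step from \<open>a\<close> to a common
  neighbour must flip one of the two coordinates in which \<open>a\<close> and \<open>c\<close> differ.\<close>

lemma third_common_neighbour:
  assumes "a \<noteq> c"
    and p: "cube_adj n a p" "cube_adj n p c"
    and q: "cube_adj n a q" "cube_adj n q c"
    and r: "cube_adj n a r" "cube_adj n r c"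
    and ne: "p \<noteq> r" "q \<noteq> r"
  shows "p = q"
proof -
  have path: "\<exists>i j. v = flip a i \<and> {k. a k \<noteq> c k} = {i, j}"
    if v: "cube_adj n a v" "cube_adj n v c" for v
  proof -
    obtain i j where i: "i < n" "v = flip a i" and j: "j < n" "c = flip v j" and a: "a \<in> cube n"
      using v by (auto simp: cube_adj_iff_flip)
    have "i \<noteq> j" using i j \<open>a \<noteq> c\<close> by auto
    then have "{k. a k \<noteq> c k} = {i, j}"
      using cube_nonzero[OF a i(1)] cube_nonzero[OF a j(1)] unfolding i j
      by (auto simp: flip_def split: if_splits)
    then show ?thesis using i by blast
  qed
  obtain i i' where i: "p = flip a i" "{k. a k \<noteq> c k} = {i, i'}" using path[OF p] by blast
  obtain j j' where j: "q = flip a j" "{k. a k \<noteq> c k} = {j, j'}" using path[OF q] by blast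
  obtain l l' where l: "r = flip a l" "{k. a k \<noteq> c k} = {l, l'}" using path[OF r] by blast
  have "i \<noteq> l" "j \<noteq> l" using i(1) j(1) l(1) ne by auto
  then have "i = j" using i(2) j(2) l(2) by (metis doubleton_eq_iff)
  then show ?thesis using i(1) j(1) by simp
qed

text \<open>Induction on the distance from \<open>b\<close>. A vertex \<open>x\<close> at distance at least two is the
  fourth corner of a square whose other corners are closer to \<open>b\<close>; its image is then the one common
  neighbour of the images of the two adjacent corners that is not the image of the opposite
  corner.\<close>

lemma automorphism_determined:
  assumes \<psi>: "cube_automorphism n \<psi>" and \<phi>: "cube_automorphism n \<phi>"
    and b: "b \<in> cube n" and base: "\<psi> b = \<phi> b"
    and nbrs: "\<And>i. i < n \<Longrightarrow> \<psi> (flip b i) = \<phi> (flip b i)"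
    and "x \<in> cube n"
  shows "\<psi> x = \<phi> x"
  using \<open>x \<in> cube n\<close>
proof (induction "card {i. i < n \<and> x i \<noteq> b i}" arbitrary: x rule: less_induct)
  case less
  note x = less.prems
  let ?D = "\<lambda>x. {i. i < n \<and> x i \<noteq> b i}"
  consider "?D x = {}" | i where "?D x = {i}" | i j where "i \<in> ?D x" "j \<in> ?D x" "i \<noteq> j"
    by blast
  then show ?case
  proof cases
    case 1
    then have "x = b" by (intro cube_ext[OF x b]) auto
    then show ?thesis using base by simp
  next
    case (2 i)
    moreover have "{i. i < n \<and> b i \<noteq> x i} = ?D x" by auto
    ultimately have "cube_adj n b x" using x b by (simp add: cube_adj_def)
    then show ?thesis using nbrs by (auto simp: cube_adj_iff_flip)
  next
    case (3 i j)
    then have ij: "i < n" "j < n" "i \<noteq> j" by auto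
    have agree: "flip y k k = b k" if "y \<in> cube n" "k \<in> ?D y" for y k
      using that cube_values[of y n k] cube_values[OF b, of k] by (auto simp: flip_def)
    have closer: "?D (flip y k) = ?D y - {k}" if "y \<in> cube n" "k \<in> ?D y" for y k
      using agree[OF that] by (auto simp: flip_def)
    define y z u where "y = flip x i" and "z = flip x j" and "u = flip y j"
    have yc: "y \<in> cube n" and zc: "z \<in> cube n" and uc: "u \<in> cube n"
      unfolding y_def z_def u_def using x ij by (auto intro!: flip_in_cube)
    have Dy: "?D y = ?D x - {i}" and Dz: "?D z = ?D x - {j}"
      unfolding y_def z_def using 3 x by (intro closer; simp)+
    have Du: "?D u = ?D x - {i} - {j}"
      unfolding u_def using closer[OF yc, of j] 3 Dy by auto
    have fin: "finite (?D x)" by simp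
    have "\<psi> y = \<phi> y" "\<psi> z = \<phi> z" "\<psi> u = \<phi> u"
      by (intro less.hyps yc zc uc, unfold Dy Dz Du, rule psubset_card_mono[OF fin], use 3 in blast)+
    note eqs = this
    have adj: "cube_adj n y x" "cube_adj n x z" "cube_adj n y u" "cube_adj n u z"
      using cube_adj_flip[OF yc ij(1)] cube_adj_flip[OF x ij(2)] cube_adj_flip[OF yc ij(2)]
        cube_adj_flip[OF uc ij(1)]
      by (simp_all add: y_def z_def u_def flip_commute[of "flip x i" j i])
    have "y \<noteq> z" using flip_index_unique[OF x ij(1), of j] ij(3) unfolding y_def z_def by blast
    have "u \<noteq> x" using flip_index_unique[OF yc ij(1), of j] ij(3)
      by (metis flip_flip u_def y_def)
    have pres: "cube_adj n (f v) (f w)"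
      if "cube_automorphism n f" "cube_adj n v w" for f v w
      using that by (auto simp: cube_automorphism_def cube_adj_def)
    have dist: "f v \<noteq> f w"
      if "cube_automorphism n f" "v \<in> cube n" "w \<in> cube n" "v \<noteq> w" for f v w
      using that by (auto simp: cube_automorphism_def bij_betw_def dest: inj_onD)
    show ?thesis
    proof (rule third_common_neighbour)
      show "\<psi> y \<noteq> \<psi> z" by (rule dist[OF \<psi> yc zc \<open>y \<noteq> z\<close>])
      show "cube_adj n (\<psi> y) (\<psi> x)" "cube_adj n (\<psi> x) (\<psi> z)"
        "cube_adj n (\<psi> y) (\<psi> u)" "cube_adj n (\<psi> u) (\<psi> z)"
        using adj by (simp_all add: pres[OF \<psi>])
      show "cube_adj n (\<psi> y) (\<phi> x)" "cube_adj n (\<phi> x) (\<psi> z)"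
        unfolding eqs using adj by (simp_all add: pres[OF \<phi>])
      show "\<psi> x \<noteq> \<psi> u" using dist[OF \<psi> uc x \<open>u \<noteq> x\<close>] by simp
      show "\<phi> x \<noteq> \<psi> u" unfolding eqs using dist[OF \<phi> uc x \<open>u \<noteq> x\<close>] by simp
    qed
  qed
qed

lemma card_automorphisms_le:
  defines "Aut \<equiv> \<lambda>n. {\<psi> \<in> extensional (cube n). cube_automorphism n \<psi>}"
  shows "finite (Aut n)" "card (Aut n) \<le> 2 ^ (n * (n + 1))"
proof -
  define b :: "nat \<Rightarrow> int" where "b = restrict (\<lambda>_. 1) {..<n}"
  have b: "b \<in> cube n" by (auto simp: b_def cube_def)
  \<comment> \<open>Position \<open>i < n\<close> records the image of the \<open>i\<close>-th neighbour of \<open>b\<close>, the last position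
    that of \<open>b\<close> itself.\<close>
  define code where
    "code = (\<lambda>\<psi>. restrict (\<lambda>i. \<psi> (if i = n then b else flip b i)) {..n} :: nat \<Rightarrow> nat \<Rightarrow> int)"
  let ?C = "{..n} \<rightarrow>\<^sub>E cube n"
  have "code \<psi> \<in> ?C" if "\<psi> \<in> Aut n" for \<psi>
    using that b flip_in_cube[OF b]
    by (fastforce simp: code_def Aut_def cube_automorphism_def dest: bij_betwE)
  then have sub: "code ` Aut n \<subseteq> ?C" by blast
  have inj: "inj_on code (Aut n)"
  proof (rule inj_onI)
    fix \<psi> \<phi> assume \<psi>: "\<psi> \<in> Aut n" and \<phi>: "\<phi> \<in> Aut n" and eq: "code \<psi> = code \<phi>"
    have "\<psi> x = \<phi> x" if x: "x \<in> cube n" for x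
    proof (rule automorphism_determined[OF _ _ b _ _ x])
      show "cube_automorphism n \<psi>" "cube_automorphism n \<phi>" using \<psi> \<phi> by (auto simp: Aut_def)
      show "\<psi> b = \<phi> b" using fun_cong[OF eq, of n] by (simp add: code_def)
      show "\<psi> (flip b i) = \<phi> (flip b i)" if "i < n" for i
        using fun_cong[OF eq, of i] that by (simp add: code_def)
    qed
    then show "\<psi> = \<phi>" using \<psi> \<phi> by (intro extensionalityI[of _ "cube n"]) (auto simp: Aut_def)
  qed
  have fin: "finite ?C" by (intro finite_PiE finite_cube) auto
  have card: "card ?C = 2 ^ (n * (n + 1))"
    by (simp add: card_PiE card_cube power_add power_mult)
  show "finite (Aut n)" by (rule inj_on_finite[OF inj sub fin])
  show "card (Aut n) \<le> 2 ^ (n * (n + 1))" using card_inj_on_le[OF inj sub fin] card by simp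
qed

section \<open>Isomorphism classes\<close>

lemma isomorphic_functions_refl: "isomorphic_functions n f f"
  unfolding isomorphic_functions_def cube_automorphism_def by (intro exI[of _ id]) auto

lemma isomorphic_functions_sym:
  assumes "isomorphic_functions n f g"
  shows "isomorphic_functions n g f"
proof -
  obtain \<psi> where bij: "bij_betw \<psi> (cube n) (cube n)"
    and adj: "\<And>x y. x \<in> cube n \<Longrightarrow> y \<in> cube n \<Longrightarrow> cube_adj n (\<psi> x) (\<psi> y) \<longleftrightarrow> cube_adj n x y"
    and fg: "\<And>x. x \<in> cube n \<Longrightarrow> f (\<psi> x) = g x"
    using assms by (auto simp: isomorphic_functions_def cube_automorphism_def)
  define \<chi> where "\<chi> = inv_into (cube n) \<psi>"
  have bij': "bij_betw \<chi> (cube n) (cube n)" unfolding \<chi>_def by (rule bij_betw_inv_into[OF bij])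
  have mem: "\<chi> x \<in> cube n" if "x \<in> cube n" for x using bij' that by (auto dest: bij_betwE)
  have inv: "\<psi> (\<chi> x) = x" if "x \<in> cube n" for x
    unfolding \<chi>_def by (rule bij_betw_inv_into_right[OF bij that])
  have "cube_adj n (\<chi> x) (\<chi> y) \<longleftrightarrow> cube_adj n x y" if "x \<in> cube n" "y \<in> cube n" for x y
    using adj[OF mem mem, of x y] inv that by simp
  moreover have "g (\<chi> x) = f x" if "x \<in> cube n" for x
    using fg[OF mem[OF that]] inv[OF that] by simp
  ultimately show ?thesis using bij'
    unfolding isomorphic_functions_def cube_automorphism_def by (intro exI[of _ \<chi>]) auto
qed

lemma card_isomorphism_class_le:
  "finite {f \<in> boolean_functions n. isomorphic_functions n b f}"
  "card {f \<in> boolean_functions n. isomorphic_functions n b f} \<le> 2 ^ (n * (n + 1))"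
proof -
  let ?Aut = "{\<psi> \<in> extensional (cube n). cube_automorphism n \<psi>}"
  let ?pull = "\<lambda>\<psi>. restrict (b \<circ> \<psi>) (cube n)"
  have sub: "{f \<in> boolean_functions n. isomorphic_functions n b f} \<subseteq> ?pull ` ?Aut"
  proof
    fix f assume "f \<in> {f \<in> boolean_functions n. isomorphic_functions n b f}"
    then obtain \<psi> where f: "f \<in> extensional (cube n)" and \<psi>: "cube_automorphism n \<psi>"
      and eq: "\<And>x. x \<in> cube n \<Longrightarrow> b (\<psi> x) = f x"
      by (auto simp: isomorphic_functions_def boolean_functions_def PiE_def)
    have "cube_automorphism n (restrict \<psi> (cube n))"
      using \<psi> by (simp add: cube_automorphism_def)
    moreover have "f = ?pull (restrict \<psi> (cube n))"
      using f eq by (intro extensionalityI[of _ "cube n"]) auto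
    ultimately show "f \<in> ?pull ` ?Aut" by (intro image_eqI[of _ _ "restrict \<psi> (cube n)"]) auto
  qed
  show "finite {f \<in> boolean_functions n. isomorphic_functions n b f}"
    using finite_boolean_functions by simp
  show "card {f \<in> boolean_functions n. isomorphic_functions n b f} \<le> 2 ^ (n * (n + 1))"
    using surj_card_le[OF card_automorphisms_le(1) sub] card_automorphisms_le(2)[of n] by linarith
qed

lemma maximal_class_represents:
  assumes B: "maximal_nonisomorphic_class n p B" and f: "locally_biased n p f"
  shows "\<exists>b\<in>B. isomorphic_functions n b f"
proof (rule ccontr)
  assume neg: "\<not> (\<exists>b\<in>B. isomorphic_functions n b f)"
  then have "f \<notin> B" using isomorphic_functions_refl by blast
  have "nonisomorphic_class n p (insert f B)"
    using B f neg isomorphic_functions_sym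
    by (auto simp: maximal_nonisomorphic_class_def nonisomorphic_class_def pairwise_insert)
  then show False using B \<open>f \<notin> B\<close> by (auto simp: maximal_nonisomorphic_class_def)
qed

lemma card_locally_biased_le:
  assumes B: "maximal_nonisomorphic_class n p B"
  shows "card {f. locally_biased n p f} \<le> card B * 2 ^ (n * (n + 1))"
proof -
  let ?K = "\<lambda>b. {f \<in> boolean_functions n. isomorphic_functions n b f}"
  have "B \<subseteq> boolean_functions n"
    using B by (auto simp: maximal_nonisomorphic_class_def nonisomorphic_class_def locally_biased_def)
  then have fin: "finite B" using finite_boolean_functions finite_subset by blast
  have "{f. locally_biased n p f} \<subseteq> (\<Union>b\<in>B. ?K b)"
    using maximal_class_represents[OF B] by (auto simp: locally_biased_def)
  then have "card {f. locally_biased n p f} \<le> card (\<Union>b\<in>B. ?K b)"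
    using fin card_isomorphism_class_le(1) by (intro card_mono) auto
  also have "\<dots> \<le> (\<Sum>b\<in>B. card (?K b))" by (rule card_UN_le[OF fin])
  also have "\<dots> \<le> card B * 2 ^ (n * (n + 1))"
    using sum_bounded_above[of B "\<lambda>b. card (?K b)" "2 ^ (n * (n + 1))"]
      card_isomorphism_class_le(2) by simp
  finally show ?thesis .
qed

section \<open>The doubling construction\<close>

definition fold_halves :: "nat \<Rightarrow> (nat \<Rightarrow> int) \<Rightarrow> nat \<Rightarrow> int" where
  "fold_halves h w = restrict (\<lambda>i. w i * w (h + i)) {..<h}"

definition doubled :: "nat \<Rightarrow> ((nat \<Rightarrow> int) \<Rightarrow> int) \<Rightarrow> ((nat \<Rightarrow> int) \<Rightarrow> int) \<Rightarrow> (nat \<Rightarrow> int) \<Rightarrow> int"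
  where "doubled h f s = restrict
    (\<lambda>w. if f (fold_halves h w) = 1 \<and> s (fold_halves h w) = (\<Prod>i<h. w i) then 1 else -1)
    (cube (2 * h))"

lemma fold_halves_in_cube: "w \<in> cube (2 * h) \<Longrightarrow> fold_halves h w \<in> cube h"
proof -
  assume w: "w \<in> cube (2 * h)"
  have "w i * w (h + i) \<in> {-1, 1}" if "i < h" for i
    using cube_values[OF w, of i] cube_values[OF w, of "h + i"] that by auto
  then show ?thesis by (auto simp: cube_def fold_halves_def)
qed

lemma fold_halves_flip:
  assumes "i < h"
  shows "fold_halves h (flip w i) = flip (fold_halves h w) i"
    and "fold_halves h (flip w (h + i)) = flip (fold_halves h w) i"
  using assms by (auto simp: fold_halves_def flip_def fun_eq_iff)

lemma prod_flip_lower: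
  assumes "i < h"
  shows "(\<Prod>j<h. flip w i j) = - (\<Prod>j<h. w j)"
proof -
  have "(\<Prod>j\<in>{..<h} - {i}. flip w i j) = (\<Prod>j\<in>{..<h} - {i}. w j)"
    by (intro prod.cong) (auto simp: flip_def)
  then show ?thesis using assms
    by (simp add: prod.remove[of "{..<h}" i] flip_def)
qed

lemma prod_flip_upper: "(\<Prod>j<h. flip w (h + i) j) = (\<Prod>j<h. w j)"
  by (intro prod.cong) (auto simp: flip_def)

lemma prod_sign: "w \<in> cube (2 * h) \<Longrightarrow> (\<Prod>i<h. w i) \<in> {-1, 1}"
proof -
  assume w: "w \<in> cube (2 * h)"
  have "(\<Prod>i\<in>S. w i) \<in> {-1, 1}" if "finite S" "S \<subseteq> {..<h}" for S
    using that
  proof (induction rule: finite_induct)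
    case (insert i S)
    then show ?case using cube_values[OF w, of i] by auto
  qed simp
  then show ?thesis by simp
qed

text \<open>Flipping coordinate \<open>i\<close> in either half has the same effect on the folded point, but only the
  flip in the lower half changes the sign of the product; so of the two exactly one agrees with
  the prescribed sign.\<close>

lemma doubled_biased:
  assumes h: "h > 0" and f: "locally_biased h (1 / real h) f"
    and s: "\<And>t. t \<in> cube h \<Longrightarrow> f t = 1 \<Longrightarrow> s t \<in> {-1, 1}"
  shows "locally_biased (2 * h) (1 / real (2 * h)) (doubled h f s)"
proof -
  have "\<exists>!j. j < 2 * h \<and> doubled h f s (flip w j) = 1" if w: "w \<in> cube (2 * h)" for w
  proof -
    let ?z = "fold_halves h w"
    define P where "P = (\<Prod>i<h. w i)"
    have z: "?z \<in> cube h" by (rule fold_halves_in_cube[OF w])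
    then obtain i where i: "i < h" "f (flip ?z i) = 1"
      and uniq: "\<And>j. j < h \<Longrightarrow> f (flip ?z j) = 1 \<Longrightarrow> j = i"
      using f h unfolding locally_biased_iff[OF h] by metis
    have lower: "doubled h f s (flip w j) = 1 \<longleftrightarrow> f (flip ?z j) = 1 \<and> s (flip ?z j) = - P"
      if "j < h" for j
      using that flip_in_cube[OF w, of j]
      by (simp add: doubled_def fold_halves_flip prod_flip_lower P_def)
    have upper: "doubled h f s (flip w (h + j)) = 1 \<longleftrightarrow> f (flip ?z j) = 1 \<and> s (flip ?z j) = P"
      if "j < h" for j
      using that flip_in_cube[OF w, of "h + j"]
      by (simp add: doubled_def fold_halves_flip prod_flip_upper P_def)
    have split: "j < 2 * h \<longleftrightarrow> j < h \<or> (\<exists>l<h. j = h + l)" for j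
      by (cases "j < h") (auto intro: exI[of _ "j - h"])
    have signs: "s (flip ?z i) \<in> {-1, 1}" "P \<in> {-1, 1}"
      unfolding P_def by (fact s[OF flip_in_cube[OF z i(1)] i(2)], fact prod_sign[OF w])
    show ?thesis
    proof (cases "s (flip ?z i) = P")
      case True
      then have no: "s (flip ?z i) \<noteq> - P" using signs by auto
      show ?thesis
      proof (rule ex1I[of _ "h + i"])
        show "h + i < 2 * h \<and> doubled h f s (flip w (h + i)) = 1"
          using i True upper[OF i(1)] by simp
        show "j = h + i" if "j < 2 * h \<and> doubled h f s (flip w j) = 1" for j
          using that lower upper uniq no unfolding split by metis
      qed
    next
      case False
      then have yes: "s (flip ?z i) = - P" using signs by auto
      show ?thesis
      proof (rule ex1I[of _ i])
        show "i < 2 * h \<and> doubled h f s (flip w i) = 1"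
          using i yes lower[OF i(1)] by simp
        show "j = i" if "j < 2 * h \<and> doubled h f s (flip w j) = 1" for j
          using that lower upper uniq False unfolding split by metis
      qed
    qed
  qed
  moreover have "doubled h f s \<in> boolean_functions (2 * h)"
    by (auto simp: boolean_functions_def doubled_def)
  ultimately show ?thesis using h by (simp add: locally_biased_iff del: of_nat_mult)
qed

text \<open>The signs can be read off the points \<open>(1, t)\<close>, which fold to \<open>t\<close> and whose lower half has
  product \<open>1\<close>.\<close>

lemma doubled_inj:
  "inj_on (doubled h f) ({t \<in> cube h. f t = 1} \<rightarrow>\<^sub>E {-1, 1})"
proof (rule inj_onI)
  fix r s
  assume r: "r \<in> {t \<in> cube h. f t = 1} \<rightarrow>\<^sub>E {-1, 1}"
    and s: "s \<in> {t \<in> cube h. f t = 1} \<rightarrow>\<^sub>E {-1, 1}"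
    and eq: "doubled h f r = doubled h f s"
  show "r = s"
  proof (rule PiE_ext[OF r s])
    fix t assume t: "t \<in> {t \<in> cube h. f t = 1}"
    define w where "w = restrict (\<lambda>i. if i < h then 1 else t (i - h)) {..<2 * h}"
    have w: "w \<in> cube (2 * h)"
      using t cube_values[of t h] by (fastforce simp: w_def cube_def)
    have fold: "fold_halves h w = t"
      using t by (intro cube_ext[OF fold_halves_in_cube[OF w]]) (auto simp: fold_halves_def w_def)
    have prod: "(\<Prod>i<h. w i) = 1"
      by (intro prod.neutral) (auto simp: w_def)
    have "(r t = 1) = (s t = 1)"
      using fun_cong[OF eq, of w] t w by (auto simp: doubled_def fold prod split: if_splits)
    moreover have "r t \<in> {-1, 1}" "s t \<in> {-1, 1}" using PiE_mem[OF r t] PiE_mem[OF s t] .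
    ultimately show "r t = s t" by auto
  qed
qed

lemma locally_biased_exists: "\<exists>f. locally_biased (2 ^ k) (1 / real (2 ^ k)) f"
proof (induction k)
  case 0
  have "restrict (\<lambda>_. 1) (cube 1) \<in> boolean_functions 1"
    by (auto simp: boolean_functions_def)
  moreover have "\<exists>!i. i < 1 \<and> restrict (\<lambda>_. 1 :: int) (cube 1) (flip x i) = 1"
    if "x \<in> cube 1" for x
    using flip_in_cube[OF that, of 0] by (intro ex1I[of _ 0]) auto
  ultimately have "locally_biased 1 (1 / real 1) (restrict (\<lambda>_. 1) (cube 1))"
    by (subst locally_biased_iff) auto
  then show ?case by auto
next
  case (Suc k)
  then obtain f where "locally_biased (2 ^ k) (1 / real (2 ^ k)) f" by blast
  from doubled_biased[OF _ this, of "\<lambda>_. 1"] show ?case by auto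
qed

text \<open>Every vertex is a neighbour of some member of the support, and each member has only \<open>h\<close>
  neighbours.\<close>

lemma card_support_ge:
  assumes h: "h > 0" and f: "locally_biased h (1 / real h) f"
  shows "2 ^ h \<le> card {t \<in> cube h. f t = 1} * h"
proof -
  let ?T = "{t \<in> cube h. f t = 1}"
  have "cube h \<subseteq> (\<lambda>(t, i). flip t i) ` (?T \<times> {..<h})"
  proof
    fix x assume x: "x \<in> cube h"
    then obtain i where i: "i < h" "f (flip x i) = 1" using f h by (auto simp: locally_biased_iff)
    then show "x \<in> (\<lambda>(t, i). flip t i) ` (?T \<times> {..<h})"
      using flip_in_cube[OF x i(1)] by (intro image_eqI[of _ _ "(flip x i, i)"]) auto
  qed
  then have "card (cube h) \<le> card (?T \<times> {..<h})"
    using finite_cube by (intro surj_card_le) auto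
  then show ?thesis by (simp add: card_cube card_cartesian_product)
qed

lemma card_locally_biased_ge:
  assumes h: "h = 2 ^ k"
  shows "\<exists>m. 2 ^ h \<le> m * h \<and> 2 ^ m \<le> card {f. locally_biased (2 * h) (1 / real (2 * h)) f}"
proof -
  have "h > 0" using h by simp
  obtain f where f: "locally_biased h (1 / real h) f" using locally_biased_exists h by blast
  let ?T = "{t \<in> cube h. f t = 1}"
  let ?S = "?T \<rightarrow>\<^sub>E {-1, 1 :: int}"
  let ?L = "{f. locally_biased (2 * h) (1 / real (2 * h)) f}"
  have "doubled h f ` ?S \<subseteq> ?L"
    using doubled_biased[OF \<open>h > 0\<close> f] by (blast dest: PiE_mem)
  moreover have "finite ?L"
    by (rule finite_subset[OF _ finite_boolean_functions[of "2 * h"]])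
      (auto simp: locally_biased_def)
  ultimately have "card ?S \<le> card ?L" using card_inj_on_le[OF doubled_inj] by blast
  moreover have "card ?S = 2 ^ card ?T"
    using finite_cube[of h] by (simp add: card_PiE numeral_2_eq_2)
  ultimately have "2 ^ card ?T \<le> card ?L" by simp
  then show ?thesis using card_support_ge[OF \<open>h > 0\<close> f] by blast
qed

section \<open>Comparison of the two counts\<close>

text \<open>With \<open>n = 2h\<close>, the exponent \<open>m \<ge> 2 ^ h / h\<close> of the number of functions exceeds
  the exponent \<open>n (n + 1)\<close> of the size of an isomorphism class by at least \<open>c n\<close>, for any fixed
  \<open>c\<close> and all large \<open>h\<close>; it suffices to choose \<open>c\<close> with \<open>A \<le> 2 ^ c\<close>.\<close>

theorem corollary3p8:
  fixes A :: real
  assumes "A > 1"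
  shows "\<exists>N::nat. \<forall>n k :: nat. n = 2 ^ k \<and> n \<ge> N \<longrightarrow>
           (\<forall>B. maximal_nonisomorphic_class n (1 / real n) B \<longrightarrow> real (card B) \<ge> A ^ n)"
proof -
  obtain c :: nat where c: "A < 2 ^ c" using real_arch_pow[of 2 A] by auto
  have "eventually (\<lambda>h::nat. real h * (2 * real h * (2 * real h + 1) + real c * (2 * real h))
      \<le> 2 ^ h) at_top"
    by real_asymp
  then obtain H where H: "\<And>h::nat. h \<ge> H \<Longrightarrow>
      real h * (2 * real h * (2 * real h + 1) + real c * (2 * real h)) \<le> 2 ^ h"
    by (auto simp: eventually_at_top_linorder)
  have "A ^ n \<le> real (card B)"
    if n: "n = 2 ^ k" "n \<ge> 2 * H + 2" and B: "maximal_nonisomorphic_class n (1 / real n) B"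
    for n k B
  proof -
    have "k \<noteq> 0" using n by (intro notI) simp
    then obtain l where k: "k = Suc l" using not0_implies_Suc by blast
    define h :: nat where "h = 2 ^ l"
    have nh: "n = 2 * h" using n k by (simp add: h_def)
    have h: "h \<ge> H" "h > 0" using n nh by auto
    obtain m where m: "2 ^ h \<le> m * h" and
      L: "2 ^ m \<le> card {f. locally_biased n (1 / real n) f}"
      using card_locally_biased_ge[OF h_def] nh by auto
    have "real (h * (n * (n + 1) + c * n)) \<le> 2 ^ h"
      using H[OF h(1)] by (simp add: nh algebra_simps)
    also have "\<dots> \<le> real (h * m)"
      using of_nat_mono[OF m, where 'a = real] by (simp add: mult.commute)
    finally have "h * (n * (n + 1) + c * n) \<le> h * m" unfolding of_nat_le_iff .
    then have "n * (n + 1) + c * n \<le> m" using h(2) by simp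
    then have "(2::nat) ^ (n * (n + 1) + c * n) \<le> 2 ^ m" by (intro power_increasing) auto
    also have "\<dots> \<le> card B * 2 ^ (n * (n + 1))"
      using L card_locally_biased_le[OF B] by linarith
    finally have "2 ^ (c * n) \<le> card B" by (simp add: power_add mult.commute)
    then have "2 ^ (c * n) \<le> real (card B)" using of_nat_mono[where 'a = real] by fastforce
    moreover have "A ^ n \<le> (2 ^ c) ^ n" using assms c by (intro power_mono) auto
    ultimately show ?thesis by (simp add: power_mult)
  qed
  then show ?thesis by blast
qed

end
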